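(* Let $j\ge0$ and $b\ge1$ be fixed integers. For $\pi=(\pi_1,\dots,\pi_m)$ chosen uniformly at random from $\mathrm{PF}(b,b,m)$, as $m\to\infty$, $$\mathbb P(\pi_1=1)=\cdots=\mathbb P(\pi_1=b)\sim\frac{2}{bm},$$ and $$\mathbb P(\pi_1=b+j)\sim\frac{1+\mathbb Q_1(\lceil j/b\rceil+1)}{bm}.$$
   Context: $\mathrm{PF}(a,b,m)$, for positive integers $a,b,m$, is the set of $(a,b)$-parking functions of length $m$: sequences $(\pi_1,\dots,\pi_m)$ of positive integers whose non-decreasing rearrangement $(\lambda_1,\dots,\lambda_m)$ satisfies $\lambda_i\le a+(i-1)b$ for all $1\le i\le m$; here $a=b$. A random variable $X$ has the Borel distribution with parameter $\mu$ ($0\le\mu\le1$) if $\mathbb P_\mu(X=n)=\frac{e^{-\mu n}(\mu n)^{n-1}}{n!}$ for $n=1,2,\dots$. Its tail function is $\mathbb Q_\mu(n)=\mathbb P_\mu(X\ge n)$. $\lceil x\rceil$ is the smallest integer $\ge x$. $f(m)\sim g(m)$ means $f(m)/g(m)\to1$ as $m\to\infty$. *)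

theory Defs
  imports "HOL-Probability.Probability" "HOL-Library.Landau_Symbols"
begin

text \<open>Lists are indexed from 0, so \<open>sort \<pi> ! i\<close> is the entry \<open>\<lambda>\<^sub>i\<^sub>+\<^sub>1\<close> of the
  non-decreasing rearrangement, and its bound \<open>a + ((i + 1) - 1) b\<close> becomes \<open>a + i * b\<close>.\<close>

definition parking_functions :: "nat \<Rightarrow> nat \<Rightarrow> nat \<Rightarrow> nat list set" where
  "parking_functions a b m =
     {\<pi>. length \<pi> = m \<and> (\<forall>x\<in>set \<pi>. 1 \<le> x) \<and> (\<forall>i<m. sort \<pi> ! i \<le> a + i * b)}"

definition random_parking_function :: "nat \<Rightarrow> nat \<Rightarrow> nat \<Rightarrow> nat list pmf" where
  "random_parking_function a b m = pmf_of_set (parking_functions a b m)"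

text \<open>The Borel distribution (unrelated to the \<open>borel\<close> sigma-algebra), as a measure on the positive
  integers; it is meant for \<open>0 \<le> \<mu> \<le> 1\<close>, where the point masses sum to 1. The convention
  \<open>0 ^ 0 = 1\<close> makes the case \<open>\<mu> = 0\<close> the point mass at 1.\<close>

definition borel_distribution :: "real \<Rightarrow> nat measure" where
  "borel_distribution \<mu> =
     point_measure {1..} (\<lambda>n. ennreal (exp (- \<mu> * real n) * (\<mu> * real n) ^ (n - 1) / fact n))"

definition borel_tail :: "real \<Rightarrow> nat \<Rightarrow> real" where
  "borel_tail \<mu> n = \<P>(k in borel_distribution \<mu>. n \<le> k)"

end

theory Submission
  imports Defs "HOL-Real_Asymp.Real_Asymp"
begin

text \<open>
  Cut the positive integers into blocks of length \<open>b\<close>. Every bound \<open>b + i b\<close> is the end of a block, so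
  membership in \<open>PF(b, b, m)\<close> depends on an entry only through its block, and with \<open>m = n + 1\<close> the
  sequences that start with a given entry of block \<open>k\<close> (blocks numbered from 0) correspond to the set
  \<open>completions b n k\<close> of possible remainders. These sets shrink as \<open>k\<close> grows. A remainder is lost
  between \<open>k\<close> and \<open>k + 1\<close> exactly when its first \<open>k + 1\<close> blocks hold \<open>k\<close> entries, and then it is a
  shuffle of a parking function of length \<open>k\<close> with a shifted parking function of length \<open>n - k\<close>
  (\<open>completions_diff\<close>).

  The number of parking functions is \<open>b\<^sup>m (m + 1)\<^bsup>m-1\<^esup>\<close> (\<open>card_parking_functions\<close>). The Borel weight
  with parameter 1 at \<open>k + 1\<close> is \<open>w\<^sub>k = e\<^bsup>-(k+1)\<^esup> (k+1)\<^sup>k / (k+1)!\<close>, so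
  \<open>|PF(b, b, k)| = b\<^sup>k k! e\<^bsup>k+1\<^esup> w\<^sub>k\<close>. In these terms the binomial coefficient counting the shuffles
  and all the exponentials cancel, and a given first entry in block \<open>k\<close> has probability
  \<open>(2 (n+1)/(n+2) - \<Sum>i<k. w\<^sub>i w\<^bsub>n-i\<^esub> / w\<^bsub>n+1\<^esub>) / (b m)\<close>
  (\<open>completion_share_eq\<close>). Consecutive weights have ratio tending to 1, so the numerator tends to
  \<open>2 - \<Sum>i<k. w\<^sub>i\<close>.

  This limit is \<open>1\<close> plus the Borel tail once \<open>\<Sum>i. w\<^sub>i = 1\<close> is known. The same counting formula proves
  it: no remainder is left at \<open>k = n + 1\<close>, which gives the convolution identity
  \<open>\<Sum>i\<le>n. w\<^sub>i w\<^bsub>n-i\<^esub> = 2 (n+1)/(n+2) w\<^bsub>n+1\<^esub>\<close>. The sum is symmetric, so its first half accounts for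
  half of the value, and Tannery's theorem lets \<open>n\<close> tend to infinity in that half
  (\<open>borel_mass_sums_1\<close>).
\<close>

section \<open>Parking functions through counting\<close>

definition count_le :: "nat \<Rightarrow> nat list \<Rightarrow> nat" where
  "count_le d xs = length (filter (\<lambda>x. x \<le> d) xs)"

lemma count_le_Cons [simp]: "count_le d (x # xs) = (if x \<le> d then Suc (count_le d xs) else count_le d xs)"
  by (simp add: count_le_def)

lemma count_le_le_length: "count_le d xs \<le> length xs"
  by (simp add: count_le_def)

lemma count_le_eq_length: "(\<And>x. x \<in> set xs \<Longrightarrow> x \<le> d) \<Longrightarrow> count_le d xs = length xs"
  by (simp add: count_le_def)

lemma count_le_eq_0: "(\<And>x. x \<in> set xs \<Longrightarrow> d < x) \<Longrightarrow> count_le d xs = 0"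
  by (simp add: count_le_def filter_empty_conv not_le)

lemma count_le_shift: "count_le (d + e) (map (\<lambda>x. x + e) xs) = count_le d xs"
  by (induction xs) (auto simp: count_le_def)

lemma count_le_filter_split:
  "count_le d xs = count_le d (filter P xs) + count_le d (filter (\<lambda>x. \<not> P x) xs)"
  by (induction xs) (auto simp: count_le_def)

lemma sorted_nth_le_iff_count_le:
  assumes "sorted xs" "i < length xs"
  shows "xs ! i \<le> d \<longleftrightarrow> i < count_le d xs"
  using assms
proof (induction xs arbitrary: i)
  case (Cons x xs)
  show ?case
  proof (cases "x \<le> d")
    case True
    then show ?thesis using Cons by (cases i) auto
  next
    case False
    then have "count_le d (x # xs) = 0"
      using Cons.prems by (intro count_le_eq_0) auto
    moreover have "\<not> (x # xs) ! i \<le> d"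
      using False Cons.prems by (cases i) (auto simp: not_le intro: less_le_trans)
    ultimately show ?thesis by simp
  qed
qed simp

lemma count_le_sort: "count_le d (sort xs) = count_le d xs"
  unfolding count_le_def by (metis mset_filter mset_sort size_mset)

text \<open>
  This form replaces sorting by counts, which add up when a sequence is split into its small and its
  large entries.
\<close>

lemma parking_functions_count_le:
  "parking_functions a b m =
     {xs. length xs = m \<and> (\<forall>x\<in>set xs. 1 \<le> x) \<and> (\<forall>i<m. i < count_le (a + i * b) xs)}"
  unfolding parking_functions_def
  by (auto simp: sorted_nth_le_iff_count_le count_le_sort)

lemma length_parking_functions: "xs \<in> parking_functions a b m \<Longrightarrow> length xs = m"
  by (simp add: parking_functions_def)

lemma parking_functions_positive: "xs \<in> parking_functions a b m \<Longrightarrow> x \<in> set xs \<Longrightarrow> 0 < x"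
  by (auto simp: parking_functions_def)

lemma finite_parking_functions [simp]: "finite (parking_functions a b m)"
proof (rule finite_subset)
  show "parking_functions a b m \<subseteq> {xs. set xs \<subseteq> {..a + m * b} \<and> length xs = m}"
  proof (clarsimp simp: parking_functions_def)
    fix xs x assume xs: "\<forall>i<length xs. sort xs ! i \<le> a + i * b" and "x \<in> set xs" "m = length xs"
    then obtain i where "i < length xs" "x = sort xs ! i"
      by (metis in_set_conv_nth length_sort set_sort)
    moreover have "a + i * b \<le> a + length xs * b" if "i < length xs" for i
      using that by simp
    ultimately show "x \<le> a + length xs * b"
      using xs le_trans by blast
  qed
qed (simp add: finite_lists_length_eq)

section \<open>Splitting a sequence into small and large entries\<close>

text \<open>
  A sequence is the same as its \<open>P\<close>-part, its other part, and the set of positions of the \<open>P\<close>-part: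
  the sequences with given parts are the shuffles of the two parts.
\<close>

lemma card_filter_split:
  assumes X: "finite X" "\<And>xs. xs \<in> X \<Longrightarrow> length xs = i \<and> (\<forall>x\<in>set xs. P x)"
    and Y: "finite Y" "\<And>ys. ys \<in> Y \<Longrightarrow> length ys = j \<and> (\<forall>y\<in>set ys. \<not> P y)"
  shows "card {zs. filter P zs \<in> X \<and> filter (\<lambda>x. \<not> P x) zs \<in> Y} = (i + j choose i) * card X * card Y"
proof -
  have filters: "filter P zs = xs \<and> filter (\<lambda>x. \<not> P x) zs = ys"
    if "zs \<in> shuffles xs ys" "xs \<in> X" "ys \<in> Y" for xs ys zs
  proof -
    have disj: "set xs \<inter> set ys = {}" using X(2) Y(2) that by blast
    have "set zs = set xs \<union> set ys" using that by (simp add: set_shuffles)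
    then have "\<forall>z\<in>set zs. P z \<longleftrightarrow> z \<in> set xs" using X(2) Y(2) that by blast
    then have "filter P zs = filter (\<lambda>x. x \<in> set xs) zs"
      "filter (\<lambda>x. \<not> P x) zs = filter (\<lambda>x. x \<notin> set xs) zs"
      by (auto intro: filter_cong)
    then show ?thesis using filter_shuffles_disjoint1[OF disj that(1)] by simp
  qed
  have "{zs. filter P zs \<in> X \<and> filter (\<lambda>x. \<not> P x) zs \<in> Y}
        = (\<Union>(xs, ys)\<in>X \<times> Y. shuffles xs ys)"
    using filters partition_in_shuffles[of _ P] by fastforce
  also have "card \<dots> = (\<Sum>(xs, ys)\<in>X \<times> Y. card (shuffles xs ys))"
  proof (subst card_UN_disjoint)
    show "\<forall>p\<in>X \<times> Y. \<forall>q\<in>X \<times> Y. p \<noteq> q \<longrightarrow>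
        (case p of (xs, ys) \<Rightarrow> shuffles xs ys) \<inter> (case q of (xs, ys) \<Rightarrow> shuffles xs ys) = {}"
    proof (intro ballI impI, rule ccontr)
      fix p q
      assume *: "p \<in> X \<times> Y" "q \<in> X \<times> Y" "p \<noteq> q"
        "(case p of (xs, ys) \<Rightarrow> shuffles xs ys) \<inter> (case q of (xs, ys) \<Rightarrow> shuffles xs ys) \<noteq> {}"
      then obtain zs where "zs \<in> shuffles (fst p) (snd p)" "zs \<in> shuffles (fst q) (snd q)"
        by (auto simp: case_prod_unfold)
      then show False
        using filters[of zs "fst p" "snd p"] filters[of zs "fst q" "snd q"] * by (auto simp: prod_eq_iff)
    qed
  qed (use X(1) Y(1) in \<open>auto simp: case_prod_unfold\<close>)
  also have "\<dots> = (\<Sum>(xs, ys)\<in>X \<times> Y. i + j choose i)"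
  proof (intro sum.cong refl, clarify)
    fix xs ys assume *: "xs \<in> X" "ys \<in> Y"
    then have "set xs \<inter> set ys = {}" using X(2) Y(2) by blast
    then show "card (shuffles xs ys) = (i + j choose i)"
      using X(2)[OF *(1)] Y(2)[OF *(2)] by (simp add: card_disjoint_shuffles)
  qed
  finally show ?thesis by (simp add: card_cartesian_product)
qed

lemma parking_functions_0 [simp]: "parking_functions a b 0 = {[]}"
  by (auto simp: parking_functions_def)

lemma map_shift_inverse:
  "(\<And>x. x \<in> set xs \<Longrightarrow> (d::nat) < x) \<Longrightarrow> map (\<lambda>x. x + d) (map (\<lambda>x. x - d) xs) = xs"
  by (auto simp: comp_def less_imp_le intro!: map_idI le_add_diff_inverse2)

lemma mem_shifted_iff:
  assumes "\<And>x. x \<in> set xs \<Longrightarrow> (d::nat) < x"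
  shows "xs \<in> map (\<lambda>x. x + d) ` A \<longleftrightarrow> map (\<lambda>x. x - d) xs \<in> A"
proof
  assume "xs \<in> map (\<lambda>x. x + d) ` A"
  then show "map (\<lambda>x. x - d) xs \<in> A" by (auto simp: comp_def)
next
  assume "map (\<lambda>x. x - d) xs \<in> A"
  then show "xs \<in> map (\<lambda>x. x + d) ` A"
    using map_shift_inverse[OF assms] by (intro image_eqI[of xs _ "map (\<lambda>x. x - d) xs"]) auto
qed

lemma shifted_mem_parking_functions:
  assumes "\<And>x. x \<in> set xs \<Longrightarrow> d < x"
  shows "xs \<in> map (\<lambda>x. x + d) ` parking_functions a b m \<longleftrightarrow>
           length xs = m \<and> (\<forall>i<m. i < count_le (a + i * b + d) xs)"
  using assms count_le_shift[of _ d "map (\<lambda>x. x - d) xs"] map_shift_inverse[OF assms]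
  by (auto simp: mem_shifted_iff parking_functions_count_le Suc_le_eq)

lemma card_shifted: "card (map (\<lambda>x. x + (d::nat)) ` A) = card A"
  by (intro card_image inj_onI) (auto dest: map_injective simp: inj_def)

section \<open>The number of parking functions\<close>

text \<open>
  The \<open>i\<close> entries in the first block satisfy the first \<open>i\<close> bounds by themselves and are
  unconstrained. The other entries, moved down by one block, have to satisfy the bounds from
  \<open>c - 1 + i\<close> blocks onwards.
\<close>

lemma parking_functions_by_low_entries:
  assumes "c \<ge> 1" "i \<le> m"
  shows "{xs \<in> parking_functions (c * b) b m. count_le b xs = i} =
    {xs. filter (\<lambda>x. x \<le> b) xs \<in> {ys. set ys \<subseteq> {1..b} \<and> length ys = i} \<and>
         filter (\<lambda>x. \<not> x \<le> b) xs \<in> map (\<lambda>x. x + b) ` parking_functions ((c - 1 + i) * b) b (m - i)}"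
    (is "?L = ?R")
proof (intro set_eqI)
  fix xs
  let ?lo = "filter (\<lambda>x. x \<le> b) xs" and ?hi = "filter (\<lambda>x. \<not> x \<le> b) xs"
  have len: "length xs = length ?lo + length ?hi"
    by (simp add: sum_length_filter_compl)
  have cb: "count_le b xs = length ?lo" by (simp add: count_le_def)
  have cnt: "count_le d xs = length ?lo + count_le d ?hi" if "b \<le> d" for d
    using that count_le_filter_split[of d xs "\<lambda>x. x \<le> b"]
    by (subst (asm) count_le_eq_length) auto
  have b_le: "b \<le> (c + t) * b" for t using assms by (cases c) auto
  have pos: "(\<forall>x\<in>set xs. 1 \<le> x) \<longleftrightarrow> set ?lo \<subseteq> {1..b}" by auto
  have idx: "(\<forall>t<m. t < count_le ((c + t) * b) xs) \<longleftrightarrow>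
        (\<forall>t<m - i. t < count_le ((c - 1 + i + t) * b + b) ?hi)" if i: "length ?lo = i"
  proof -
    have th: "(c - 1 + i + t) * b + b = (c + (i + t)) * b" for t
      using assms(1) by (cases c) (auto simp: algebra_simps)
    have "(\<forall>t<m. t < count_le ((c + t) * b) xs) \<longleftrightarrow> (\<forall>t<m. t < i + count_le ((c + t) * b) ?hi)"
      using cnt[OF b_le] i by simp
    also have "\<dots> \<longleftrightarrow> (\<forall>t<m - i. i + t < i + count_le ((c + (i + t)) * b) ?hi)"
    proof safe
      fix t assume *: "\<forall>t<m - i. i + t < i + count_le ((c + (i + t)) * b) ?hi" "t < m"
      show "t < i + count_le ((c + t) * b) ?hi"
      proof (cases "t < i")
        case False
        then have "t - i < m - i" "i + (t - i) = t" using *(2) by auto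
        then show ?thesis using *(1) by metis
      qed simp
    qed (metis less_diff_conv add.commute)
    finally show ?thesis by (simp only: th add_less_cancel_left)
  qed
  have hi: "?hi \<in> map (\<lambda>x. x + b) ` parking_functions ((c - 1 + i) * b) b (m - i) \<longleftrightarrow>
      length ?hi = m - i \<and> (\<forall>t<m - i. t < count_le ((c - 1 + i + t) * b + b) ?hi)"
    by (subst shifted_mem_parking_functions) (auto simp: algebra_simps)
  have "xs \<in> ?L \<longleftrightarrow> length xs = m \<and> (\<forall>x\<in>set xs. 1 \<le> x)
      \<and> (\<forall>t<m. t < count_le ((c + t) * b) xs) \<and> length ?lo = i"
    by (simp add: parking_functions_count_le cb algebra_simps)
  also have "\<dots> \<longleftrightarrow> length ?lo = i \<and> length ?hi = m - i \<and> set ?lo \<subseteq> {1..b}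
      \<and> (\<forall>t<m - i. t < count_le ((c - 1 + i + t) * b + b) ?hi)"
    using idx pos len assms(2) by auto
  also have "\<dots> \<longleftrightarrow> xs \<in> ?R" using hi by auto
  finally show "xs \<in> ?L \<longleftrightarrow> xs \<in> ?R" .
qed

lemma card_parking_functions_rec:
  assumes "c \<ge> 1"
  shows "card (parking_functions (c * b) b m) =
    (\<Sum>i\<le>m. (m choose i) * b ^ i * card (parking_functions ((c - 1 + i) * b) b (m - i)))"
proof -
  have "parking_functions (c * b) b m =
      (\<Union>i\<le>m. {xs \<in> parking_functions (c * b) b m. count_le b xs = i})"
    using count_le_le_length by (auto simp: parking_functions_def)
  also have "card \<dots> = (\<Sum>i\<le>m. card {xs \<in> parking_functions (c * b) b m. count_le b xs = i})"
    by (subst card_UN_disjoint) auto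
  also have "\<dots> = (\<Sum>i\<le>m. (m choose i) * b ^ i * card (parking_functions ((c - 1 + i) * b) b (m - i)))"
  proof (intro sum.cong refl)
    fix i assume "i \<in> {..m}"
    then have i: "i \<le> m" by simp
    let ?Y = "map (\<lambda>x. x + b) ` parking_functions ((c - 1 + i) * b) b (m - i)"
    have "card {xs. filter (\<lambda>x. x \<le> b) xs \<in> {ys. set ys \<subseteq> {1..b} \<and> length ys = i} \<and>
         filter (\<lambda>x. \<not> x \<le> b) xs \<in> ?Y}
       = (i + (m - i) choose i) * card {ys. set ys \<subseteq> {1..b} \<and> length ys = i} * card ?Y"
      by (rule card_filter_split)
         (use parking_functions_positive[where x = 0] in \<open>auto simp: finite_lists_length_eq length_parking_functions\<close>)
    then show "card {xs \<in> parking_functions (c * b) b m. count_le b xs = i} =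
        (m choose i) * b ^ i * card (parking_functions ((c - 1 + i) * b) b (m - i))"
      using i by (simp only: parking_functions_by_low_entries[OF assms i])
                 (simp add: card_lists_length_eq card_shifted)
  qed
  finally show ?thesis .
qed

lemma sum_binomial_index:
  fixes x :: nat
  shows "(\<Sum>i\<le>m. (m choose i) * i * x ^ (m - i)) = m * (x + 1) ^ (m - 1)"
proof (cases m)
  case (Suc n)
  have "(\<Sum>i\<le>Suc n. (Suc n choose i) * i * x ^ (Suc n - i))
      = (\<Sum>i\<le>n. (Suc n choose Suc i) * Suc i * x ^ (n - i))"
    by (subst sum.atMost_Suc_shift) simp
  also have "\<dots> = (\<Sum>i\<le>n. Suc n * ((n choose i) * x ^ (n - i)))"
    by (intro sum.cong refl) (metis Suc_times_binomial_eq mult.assoc mult.commute)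
  also have "\<dots> = Suc n * (1 + x) ^ n"
    by (subst binomial_ring) (simp add: sum_distrib_left)
  finally show ?thesis using Suc by (simp add: add.commute)
qed simp

text \<open>
  The count is \<open>b\<^sup>m c (c + m)\<^bsup>m-1\<^esup>\<close>; multiplying by \<open>c + m\<close> avoids the exponent \<open>m - 1\<close>. In
  the recursion all terms on the right have the same value \<open>x = c + m - 1\<close> of the parameter sum,
  which is why induction over \<open>c + m\<close> reduces the formula to the binomial theorem at \<open>x + 1\<close>.
\<close>

lemma card_parking_functions:
  "card (parking_functions (c * b) b m) * (c + m) = b ^ m * c * (c + m) ^ m"
proof (induction "c + m" arbitrary: c m rule: less_induct)
  case less
  show ?case
  proof (cases "m = 0 \<or> c = 0")
    case True
    have "parking_functions 0 b m = {}" if "m > 0"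
    proof -
      have "count_le 0 xs = 0" if "\<forall>x\<in>set xs. 1 \<le> x" for xs
        using that by (intro count_le_eq_0) auto
      with that show ?thesis by (force simp: parking_functions_count_le)
    qed
    then show ?thesis using True by (cases "m = 0") auto
  next
    case False
    define x where "x = c + m - 1"
    have x: "x > 0" "c + m = x + 1" using False by (auto simp: x_def)
    have IH: "card (parking_functions ((c - 1 + i) * b) b (m - i)) * x
        = b ^ (m - i) * (c - 1 + i) * x ^ (m - i)" if "i \<le> m" for i
    proof -
      have eq: "c - 1 + i + (m - i) = x" using that False by (auto simp: x_def)
      show ?thesis using less[of "c - 1 + i" "m - i"] eq x by simp
    qed
    have "card (parking_functions (c * b) b m) * x
        = (\<Sum>i\<le>m. (m choose i) * b ^ i * (card (parking_functions ((c - 1 + i) * b) b (m - i)) * x))"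
      using False by (subst card_parking_functions_rec) (auto simp: sum_distrib_right mult.assoc)
    also have "\<dots> = (\<Sum>i\<le>m. b ^ m * ((c - 1) * ((m choose i) * x ^ (m - i))
        + (m choose i) * i * x ^ (m - i)))"
    proof (intro sum.cong refl)
      fix i assume "i \<in> {..m}"
      then have i: "i \<le> m" by simp
      then have "b ^ m = b ^ i * b ^ (m - i)" by (simp flip: power_add)
      then show "(m choose i) * b ^ i * (card (parking_functions ((c - 1 + i) * b) b (m - i)) * x)
          = b ^ m * ((c - 1) * ((m choose i) * x ^ (m - i)) + (m choose i) * i * x ^ (m - i))"
        by (subst IH[OF i]) (simp add: algebra_simps)
    qed
    also have "\<dots> = b ^ m * ((c - 1) * (\<Sum>i\<le>m. (m choose i) * x ^ (m - i)) + m * (x + 1) ^ (m - 1))"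
      by (simp only: sum_distrib_left[symmetric] sum.distrib sum_binomial_index)
    also have "(\<Sum>i\<le>m. (m choose i) * x ^ (m - i)) = (x + 1) ^ m"
      using binomial_ring[of 1 x m] by (simp add: add.commute)
    finally have "card (parking_functions (c * b) b m) * x
        = b ^ m * ((c - 1) * (x + 1) ^ m + m * (x + 1) ^ (m - 1))" .
    then have "card (parking_functions (c * b) b m) * (x + 1) * x
        = b ^ m * ((c - 1) * (x + 1) ^ m + m * (x + 1) ^ (m - 1)) * (x + 1)"
      by (metis mult.assoc mult.commute)
    also have "\<dots> = b ^ m * ((c - 1) * (x + 1) ^ m * (x + 1) + m * ((x + 1) ^ (m - 1) * (x + 1)))"
      by (simp add: algebra_simps)
    also have "(x + 1) ^ (m - 1) * (x + 1) = (x + 1) ^ m"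
      using False by (metis not_gr_zero power_minus_mult)
    also have "(c - 1) * (x + 1) ^ m * (x + 1) + m * (x + 1) ^ m
        = ((c - 1) * (x + 1) + m) * (x + 1) ^ m" by (simp add: algebra_simps)
    also have "(c - 1) * (x + 1) + m = c * x"
      using False by (cases c) (auto simp: x_def algebra_simps)
    finally have "card (parking_functions (c * b) b m) * (x + 1) * x
        = (b ^ m * c * (x + 1) ^ m) * x" by (simp add: ac_simps)
    then show ?thesis using x by simp
  qed
qed

lemma card_parking_functions_pos: "b \<ge> 1 \<Longrightarrow> card (parking_functions b b m) > 0"
  using card_parking_functions[of 1 b m] by (intro Nat.gr0I) auto

section \<open>Sequences with a prescribed first entry\<close>

text \<open>
  The remainders, of length \<open>n\<close>, that follow a first entry lying in block \<open>k\<close>, blocks being numbered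
  from 0. The bound at the end of block \<open>i\<close> asks for \<open>i + 1\<close> entries, and the first entry is one of
  them from \<open>i = k\<close> on.
\<close>

definition completions :: "nat \<Rightarrow> nat \<Rightarrow> nat \<Rightarrow> nat list set" where
  "completions b n k = {xs. length xs = n \<and> (\<forall>x\<in>set xs. 1 \<le> x) \<and>
     (\<forall>i\<le>n. (if i < k then Suc i else i) \<le> count_le (Suc i * b) xs)}"

lemma Cons_mem_parking_functions:
  assumes "1 \<le> x" "b \<ge> 1"
  shows "x # xs \<in> parking_functions b b (Suc n) \<longleftrightarrow> xs \<in> completions b n ((x - 1) div b)"
proof -
  have "x \<le> b + i * b \<longleftrightarrow> \<not> i < (x - 1) div b" for i
  proof -
    have "i < (x - 1) div b \<longleftrightarrow> Suc i * b \<le> x - 1"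
      using assms by (simp add: less_eq_div_iff_mult_less_eq flip: Suc_le_eq)
    then show ?thesis using assms by auto
  qed
  then show ?thesis using assms
    by (auto simp: parking_functions_count_le completions_def less_Suc_eq_le Suc_le_eq)
qed

text \<open>
  A first entry in block 0 serves every bound, which relaxes each bound for the remainder by one block.
\<close>

lemma completions_0: "completions b n 0 = parking_functions (2 * b) b n"
proof -
  have "(\<forall>i\<le>n. i \<le> count_le (Suc i * b) xs) \<longleftrightarrow> (\<forall>i<n. i < count_le (2 * b + i * b) xs)"
    (is "?l \<longleftrightarrow> ?r") for xs
  proof
    assume ?l
    then show ?r by (metis Suc_le_eq add.assoc mult_2 mult_Suc)
  next
    assume r: ?r
    show ?l
    proof (intro allI impI)
      fix i assume "i \<le> n"
      then show "i \<le> count_le (Suc i * b) xs"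
        using r by (cases i) (auto simp: Suc_le_eq add.assoc mult_2)
    qed
  qed
  then show ?thesis unfolding completions_def parking_functions_count_le by simp
qed

lemma completions_Suc_length: "completions b n (Suc n) = {}"
  by (auto simp: completions_def dest!: spec[of _ n])
     (metis Suc_n_not_le_n add.commute count_le_le_length le_trans)

lemma completions_antimono: "completions b n (Suc k) \<subseteq> completions b n k"
proof
  fix xs assume xs: "xs \<in> completions b n (Suc k)"
  have "(if i < k then Suc i else i) \<le> (if i < Suc k then Suc i else i)" for i by simp
  with xs show "xs \<in> completions b n k"
    unfolding completions_def by (blast intro: order_trans)
qed

lemma finite_completions [simp]: "finite (completions b n k)"
proof -
  have "completions b n k \<subseteq> completions b n 0"
    by (rule lift_Suc_antimono_le[of "completions b n"]) (auto simp: completions_antimono)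
  then show ?thesis by (auto simp: completions_0 intro: finite_subset)
qed

text \<open>
  Passing from \<open>k\<close> to \<open>k + 1\<close> changes only the requirement at the end of block \<open>k\<close>, from at least \<open>k\<close>
  to at least \<open>k + 1\<close> entries. A lost remainder therefore has exactly \<open>k\<close> entries up to there. This
  decouples the two sides: the earlier bounds concern only the small entries, and the later ones say
  that the large entries, moved down, form a parking function too.
\<close>

lemma completions_diff:
  assumes "k \<le> n"
  shows "completions b n k - completions b n (Suc k) =
    {xs. filter (\<lambda>x. x \<le> Suc k * b) xs \<in> parking_functions b b k \<and>
         filter (\<lambda>x. \<not> x \<le> Suc k * b) xs \<in> map (\<lambda>x. x + Suc k * b) ` parking_functions b b (n - k)}"
    (is "?L = ?R")
proof (intro set_eqI)
  fix xs
  let ?d = "Suc k * b"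
  let ?lo = "filter (\<lambda>x. x \<le> ?d) xs" and ?hi = "filter (\<lambda>x. \<not> x \<le> ?d) xs"
  have len: "length xs = length ?lo + length ?hi"
    by (simp only: sum_length_filter_compl)
  have cd: "count_le ?d xs = length ?lo" by (simp add: count_le_def)
  have high: "count_le d xs = length ?lo + count_le d ?hi" if "?d \<le> d" for d
    using that count_le_filter_split[of d xs "\<lambda>x. x \<le> ?d"]
    by (subst (asm) count_le_eq_length) auto
  have low: "count_le d xs = count_le d ?lo" if "d \<le> ?d" for d
    using that count_le_filter_split[of d xs "\<lambda>x. x \<le> ?d"]
    by (subst (asm) (3) count_le_eq_0) auto
  have pos: "(\<forall>x\<in>set xs. 1 \<le> x) \<longleftrightarrow> (\<forall>x\<in>set ?lo. 1 \<le> x)" by auto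
  have lows: "(\<forall>i<k. Suc i \<le> count_le (Suc i * b) xs) \<longleftrightarrow> (\<forall>i<k. i < count_le (b + i * b) ?lo)"
  proof -
    have "Suc i * b \<le> ?d" if "i < k" for i using that by simp
    then show ?thesis using low by (auto simp: Suc_le_eq)
  qed
  have highs: "(\<forall>i\<le>n. k < i \<longrightarrow> i \<le> count_le (Suc i * b) xs) \<longleftrightarrow>
      (\<forall>i<n - k. i < count_le (b + i * b + ?d) ?hi)" if "length ?lo = k"
  proof -
    have "(\<forall>i\<le>n. k < i \<longrightarrow> i \<le> count_le (Suc i * b) xs) \<longleftrightarrow>
        (\<forall>i<n - k. Suc (k + i) \<le> count_le (Suc (Suc (k + i)) * b) xs)"
    proof safe
      fix i assume *: "\<forall>i<n - k. Suc (k + i) \<le> count_le (Suc (Suc (k + i)) * b) xs" "i \<le> n" "k < i"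
      then have "i - Suc k < n - k" "Suc (k + (i - Suc k)) = i" by auto
      then show "i \<le> count_le (Suc i * b) xs" using *(1) by metis
    next
      fix i assume *: "\<forall>i\<le>n. k < i \<longrightarrow> i \<le> count_le (Suc i * b) xs" "i < n - k"
      then show "Suc (k + i) \<le> count_le (Suc (Suc (k + i)) * b) xs"
        by (intro *(1)[rule_format]) auto
    qed
    also have "\<dots> \<longleftrightarrow> (\<forall>i<n - k. i < count_le (b + i * b + ?d) ?hi)"
    proof -
      have "Suc (Suc (k + i)) * b = b + i * b + ?d" for i by (simp add: algebra_simps)
      moreover have "count_le (b + i * b + ?d) xs = k + count_le (b + i * b + ?d) ?hi" for i
        using high[of "b + i * b + ?d"] that by (simp only: le_add2)
      ultimately show ?thesis by (simp only: Suc_le_eq add_less_cancel_left)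
    qed
    finally show ?thesis .
  qed
  have hi: "?hi \<in> map (\<lambda>x. x + ?d) ` parking_functions b b (n - k) \<longleftrightarrow>
      length ?hi = n - k \<and> (\<forall>i<n - k. i < count_le (b + i * b + ?d) ?hi)"
    by (subst shifted_mem_parking_functions) (auto simp: not_le)
  have "xs \<in> ?L \<longleftrightarrow> length xs = n \<and> (\<forall>x\<in>set xs. 1 \<le> x) \<and>
      (\<forall>i<k. Suc i \<le> count_le (Suc i * b) xs) \<and> count_le ?d xs = k \<and>
      (\<forall>i\<le>n. k < i \<longrightarrow> i \<le> count_le (Suc i * b) xs)" (is "_ \<longleftrightarrow> ?M")
  proof -
    \<comment> \<open>The requirements for \<open>j = k\<close> and \<open>j = k + 1\<close> differ only at \<open>i = k\<close>.\<close>
    have *: "(\<forall>i\<le>n. (if i < j then Suc i else i) \<le> count_le (Suc i * b) xs) \<longleftrightarrow>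
        (\<forall>i<k. Suc i \<le> count_le (Suc i * b) xs) \<and>
        (if k < j then Suc k else k) \<le> count_le ?d xs \<and>
        (\<forall>i\<le>n. k < i \<longrightarrow> i \<le> count_le (Suc i * b) xs)" (is "?l \<longleftrightarrow> ?r")
      if "j = k \<or> j = Suc k" for j
    proof
      assume l: ?l
      show ?r
      proof (intro conjI allI impI)
        fix i assume "i < k"
        then show "Suc i \<le> count_le (Suc i * b) xs" using l[rule_format, of i] that assms by auto
      next
        show "(if k < j then Suc k else k) \<le> count_le ?d xs" using l assms by blast
      next
        fix i assume "i \<le> n" "k < i"
        then show "i \<le> count_le (Suc i * b) xs" using l[rule_format, of i] that by auto
      qed
    next
      assume r: ?r
      show ?l
      proof (intro allI impI)
        fix i assume "i \<le> n"
        then show "(if i < j then Suc i else i) \<le> count_le (Suc i * b) xs"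
          using r that by (cases i k rule: linorder_cases) auto
      qed
    qed
    show ?thesis using *[of k] *[of "Suc k"] by (auto simp: completions_def)
  qed
  also have "?M \<longleftrightarrow> length ?lo = k \<and> length ?hi = n - k \<and> (\<forall>x\<in>set ?lo. 1 \<le> x) \<and>
      (\<forall>i<k. i < count_le (b + i * b) ?lo) \<and> (\<forall>i<n - k. i < count_le (b + i * b + ?d) ?hi)"
    unfolding cd pos lows using highs len assms by auto
  also have "\<dots> \<longleftrightarrow> xs \<in> ?R"
    unfolding mem_Collect_eq hi by (auto simp: parking_functions_count_le)
  finally show "xs \<in> ?L \<longleftrightarrow> xs \<in> ?R" .
qed

lemma parking_function_entry_le:
  assumes "xs \<in> parking_functions b b k" "x \<in> set xs"
  shows "x \<le> k * b"
proof -
  obtain i where i: "i < k" "x = sort xs ! i"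
    using assms unfolding parking_functions_def
    by (metis (mono_tags, lifting) in_set_conv_nth length_sort mem_Collect_eq set_sort)
  then have "x \<le> Suc i * b" using assms by (simp add: parking_functions_def)
  also have "\<dots> \<le> k * b" using i by (intro mult_le_mono1) simp
  finally show ?thesis .
qed

lemma card_completions_Suc:
  assumes "k \<le> n"
  shows "card (completions b n k) = card (completions b n (Suc k)) +
    (n choose k) * card (parking_functions b b k) * card (parking_functions b b (n - k))"
proof -
  let ?Y = "map (\<lambda>x. x + Suc k * b) ` parking_functions b b (n - k)"
  have "card (completions b n k - completions b n (Suc k))
      = (k + (n - k) choose k) * card (parking_functions b b k) * card ?Y"
    unfolding completions_diff[OF assms]
  proof (rule card_filter_split)
    show "length xs = k \<and> (\<forall>x\<in>set xs. x \<le> Suc k * b)" if "xs \<in> parking_functions b b k" for xs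
      using parking_function_entry_le[OF that] that
      by (auto simp: parking_functions_def intro: trans_le_add2)
  qed (use parking_functions_positive[where x = 0] in \<open>auto simp: length_parking_functions\<close>)
  then have "card (completions b n k - completions b n (Suc k))
      = (n choose k) * card (parking_functions b b k) * card (parking_functions b b (n - k))"
    using assms by (simp add: card_shifted)
  moreover have "card (completions b n k) = card (completions b n (Suc k))
      + card (completions b n k - completions b n (Suc k))"
    using completions_antimono[of b n k]
    by (metis card_mono card_Diff_subset finite_completions finite_subset le_add_diff_inverse)
  ultimately show ?thesis by simp
qed

section \<open>Counts in terms of Borel weights\<close>

text \<open>
  The mass of the Borel distribution with parameter 1 at \<open>k + 1\<close>. The shift matches the length \<open>k\<close> of
  the parking functions that this weight counts.
\<close>

definition borel_mass :: "nat \<Rightarrow> real" where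
  "borel_mass k = exp (- real (Suc k)) * real (Suc k) ^ k / fact (Suc k)"

lemma borel_mass_pos: "borel_mass k > 0"
  by (simp add: borel_mass_def)

lemma card_parking_functions_borel_mass:
  "real (card (parking_functions b b k)) = real b ^ k * fact k * exp (real (Suc k)) * borel_mass k"
proof -
  have "card (parking_functions b b k) * Suc k = b ^ k * Suc k ^ k"
    using card_parking_functions[of 1 b k] by simp
  then have "real (card (parking_functions b b k)) * real (Suc k) = real b ^ k * real (Suc k) ^ k"
    by (metis of_nat_mult of_nat_power)
  then have "real (card (parking_functions b b k)) = real b ^ k * real (Suc k) ^ k / real (Suc k)"
    by (simp add: eq_divide_eq del: of_nat_Suc)
  also have "\<dots> = real b ^ k * fact k * exp (real (Suc k)) * borel_mass k"
    by (simp add: borel_mass_def exp_minus field_simps del: of_nat_Suc)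
  finally show ?thesis .
qed

text \<open>
  The probability that a random parking function of length \<open>n + 1\<close> starts with a given entry of
  block \<open>k\<close>; see \<open>prob_first_entry\<close> below.
\<close>

definition completion_share :: "nat \<Rightarrow> nat \<Rightarrow> nat \<Rightarrow> real" where
  "completion_share b n k = card (completions b n k) / card (parking_functions b b (Suc n))"

lemma completion_share_0:
  assumes "b \<ge> 1"
  shows "completion_share b n 0 = 2 / (real b * real (n + 2))"
proof -
  have "card (completions b n 0) * (n + 2) = b ^ n * 2 * (n + 2) ^ n"
    using card_parking_functions[of 2 b n] by (simp add: completions_0 add.commute)
  moreover have "card (parking_functions b b (Suc n)) * (n + 2) = b * (b ^ n * (n + 2) ^ n) * (n + 2)"
    using card_parking_functions[of 1 b "Suc n"] by (simp add: algebra_simps)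
  then have "card (parking_functions b b (Suc n)) = b * (b ^ n * (n + 2) ^ n)"
    by (metis mult_cancel2 add_is_0 zero_neq_numeral)
  ultimately have "card (completions b n 0) * (n + 2) * b = 2 * card (parking_functions b b (Suc n))"
    by simp
  then have "real (card (completions b n 0)) * (real b * real (n + 2)) =
      2 * real (card (parking_functions b b (Suc n)))"
    by (metis mult.assoc mult.commute of_nat_mult of_nat_numeral)
  moreover have "real b * real (n + 2) \<noteq> 0" "real (card (parking_functions b b (Suc n))) \<noteq> 0"
    using assms card_parking_functions_pos[OF assms, of "Suc n"]
    by (simp_all only: mult_eq_0_iff of_nat_eq_0_iff) simp_all
  ultimately show ?thesis
    unfolding completion_share_def by (subst frac_eq_eq)
qed

text \<open>
  The factorials from the counts of the two parts cancel against the binomial coefficient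
  of the shuffles, and the exponentials multiply to the one in the total count.
\<close>

lemma completion_share_Suc:
  assumes "b \<ge> 1" "k \<le> n"
  shows "completion_share b n k = completion_share b n (Suc k) +
    borel_mass k * (borel_mass (n - k) / borel_mass (Suc n)) / (real b * real (Suc n))"
proof -
  have "real ((n choose k) * card (parking_functions b b k) * card (parking_functions b b (n - k)))
      = real b ^ (k + (n - k)) * fact n * exp (real (Suc k) + real (Suc (n - k)))
         * borel_mass k * borel_mass (n - k)"
    unfolding of_nat_mult card_parking_functions_borel_mass binomial_fact[OF assms(2)] exp_add power_add
    by simp
  also have "real (Suc k) + real (Suc (n - k)) = real (Suc (Suc n))"
    using assms(2) by simp
  also have "k + (n - k) = n" using assms(2) by simp
  finally have "real ((n choose k) * card (parking_functions b b k) * card (parking_functions b b (n - k)))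
        / card (parking_functions b b (Suc n))
      = borel_mass k * (borel_mass (n - k) / borel_mass (Suc n)) / (real b * real (Suc n))"
    using assms borel_mass_pos[of "Suc n"]
    by (simp add: card_parking_functions_borel_mass field_simps del: of_nat_Suc)
  then show ?thesis
    using card_completions_Suc[OF assms(2), of b]
    by (simp add: completion_share_def add_divide_distrib del: of_nat_Suc)
qed

lemma completion_share_eq:
  assumes "b \<ge> 1" "k \<le> Suc n"
  shows "completion_share b n k = 2 / (real b * real (n + 2)) -
    (\<Sum>i<k. borel_mass i * (borel_mass (n - i) / borel_mass (Suc n))) / (real b * real (Suc n))"
  using assms(2)
proof (induction k)
  case 0
  then show ?case using completion_share_0[OF assms(1)] by simp
next
  case (Suc k)
  then have "k \<le> n" by simp
  show ?case
    using completion_share_Suc[OF assms(1) \<open>k \<le> n\<close>] Suc.IH \<open>k \<le> n\<close>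
    unfolding sum.lessThan_Suc add_divide_distrib by linarith
qed

section \<open>The Borel weights sum to 1\<close>

text \<open>
  No remainder of length \<open>n\<close> fits a first entry beyond the last block, so the sum over
  all \<open>k \<le> n\<close> of the losses exhausts the remainders for block 0.
\<close>

lemma borel_mass_convolution:
  "(\<Sum>i<Suc n. borel_mass i * borel_mass (n - i)) = 2 * real (Suc n) / real (n + 2) * borel_mass (Suc n)"
proof -
  define S where "S = (\<Sum>i<Suc n. borel_mass i * (borel_mass (n - i) / borel_mass (Suc n)))"
  have "completion_share 1 n (Suc n) = 0"
    by (simp add: completion_share_def completions_Suc_length)
  then have "S / real (Suc n) = 2 / real (n + 2)"
    using completion_share_eq[of 1 "Suc n" n] by (simp add: S_def del: sum.lessThan_Suc)
  then have "S = 2 * real (Suc n) / real (n + 2)"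
    by (simp add: divide_eq_eq del: of_nat_Suc of_nat_add)
  moreover have "S = (\<Sum>i<Suc n. borel_mass i * borel_mass (n - i)) / borel_mass (Suc n)"
    by (simp add: S_def sum_divide_distrib add_divide_distrib)
  ultimately show ?thesis
    using borel_mass_pos[of "Suc n"]
    by (simp add: divide_eq_eq del: of_nat_Suc of_nat_add sum.lessThan_Suc)
qed

text \<open>
  The convolution identity at \<open>n = 2 h - 1\<close>, where the sum has an even number of terms and the symmetry
  \<open>i \<mapsto> n - i\<close> exchanges its two halves.
\<close>

lemma borel_mass_half_convolution:
  "(\<Sum>i<h. borel_mass i * (borel_mass (2 * h - 1 - i) / borel_mass (2 * h))) = 2 * real h / (2 * real h + 1)"
proof (cases h)
  case (Suc g)
  define n where "n = 2 * h - 1"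
  have n: "Suc n = 2 * h" using Suc by (simp add: n_def)
  let ?t = "\<lambda>i. borel_mass i * borel_mass (n - i)"
  have "sum ?t {h..<2*h} = sum ?t {..<h}"
    by (rule sum.reindex_bij_witness[of _ "\<lambda>i. n - i" "\<lambda>i. n - i"])
       (auto simp: mult.commute n_def)
  moreover have "sum ?t {..<2*h} = sum ?t {..<h} + sum ?t {h..<2*h}"
    by (subst sum.union_disjoint[symmetric]) (auto intro: sum.cong)
  moreover have "sum ?t {..<2*h} = 2 * (2 * real h / (2 * real h + 1) * borel_mass (2 * h))"
    using borel_mass_convolution[of n] n by (simp add: add.commute)
  ultimately have "sum ?t {..<h} = 2 * real h / (2 * real h + 1) * borel_mass (2 * h)" by linarith
  then show ?thesis
    using borel_mass_pos[of "2 * h"]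
    by (simp add: n_def sum_divide_distrib[symmetric] divide_eq_eq)
qed simp

lemma borel_mass_Suc:
  "borel_mass n = exp 1 * (real (Suc n) / real (Suc (Suc n))) ^ n * borel_mass (Suc n)"
proof -
  have "exp (- real (Suc n)) = exp 1 * exp (- real (Suc (Suc n)))"
    by (simp flip: exp_add)
  then show ?thesis
    by (simp add: borel_mass_def power_divide field_simps del: of_nat_Suc)
qed

lemma borel_mass_Suc_le: "borel_mass (Suc n) \<le> borel_mass n"
proof -
  let ?r = "1 + 1 / real (Suc n)"
  have "?r ^ n \<le> ?r ^ Suc n" by (rule power_increasing) auto
  also have "\<dots> \<le> exp 1" by (rule exp_ge_one_plus_x_over_n_power_n) auto
  finally have "1 \<le> exp 1 / ?r ^ n" by (simp add: le_divide_eq add_pos_pos)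
  also have "\<dots> = exp 1 * (real (Suc n) / real (Suc (Suc n))) ^ n"
  proof -
    have "real (Suc n) / real (Suc (Suc n)) = inverse ?r" by (simp add: field_simps)
    then show ?thesis by (simp only: divide_inverse power_inverse)
  qed
  finally show ?thesis
    using borel_mass_pos[of "Suc n"] by (subst borel_mass_Suc) (simp add: mult_le_cancel_right1)
qed

text \<open>
  Together with monotonicity this bounds quotients of weights without Stirling's formula. The
  exponent is \<open>1 - n / (n + 2)\<close>, obtained from \<open>1 - 1 / (n + 2) \<le> exp (- 1 / (n + 2))\<close>.
\<close>

lemma borel_mass_le_Suc: "borel_mass n \<le> exp (2 / real (n + 2)) * borel_mass (Suc n)"
proof -
  have "real (Suc n) / real (Suc (Suc n)) = 1 + - (1 / real (n + 2))" by (simp add: field_simps)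
  also have "\<dots> \<le> exp (- (1 / real (n + 2)))" by (rule exp_ge_add_one_self)
  finally have "(real (Suc n) / real (Suc (Suc n))) ^ n \<le> exp (- (1 / real (n + 2))) ^ n"
    by (intro power_mono) auto
  also have "\<dots> = exp (- (real n / real (n + 2)))" by (simp flip: exp_of_nat_mult)
  finally have "exp 1 * (real (Suc n) / real (Suc (Suc n))) ^ n \<le> exp 1 * exp (- (real n / real (n + 2)))"
    by simp
  also have "\<dots> = exp (2 / real (n + 2))"
    by (simp add: field_simps flip: exp_add)
  finally show ?thesis
    using borel_mass_pos[of "Suc n"] by (subst borel_mass_Suc) simp
qed

lemma borel_mass_antimono: "m \<le> n \<Longrightarrow> borel_mass n \<le> borel_mass m"
  by (rule lift_Suc_antimono_le) (simp_all add: borel_mass_Suc_le)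

lemma borel_mass_ratio_le: "borel_mass n / borel_mass (n + d) \<le> exp (2 * real d / real (n + 2))"
proof (induction d)
  case (Suc d)
  have "borel_mass n / borel_mass (n + Suc d)
      = borel_mass n / borel_mass (n + d) * (borel_mass (n + d) / borel_mass (Suc (n + d)))"
    using borel_mass_pos[of "n + d"] by simp
  also have "\<dots> \<le> exp (2 * real d / real (n + 2)) * exp (2 / real (n + d + 2))"
    using Suc borel_mass_le_Suc[of "n + d"] borel_mass_pos
    by (intro mult_mono) (auto simp: divide_le_eq less_imp_le)
  also have "\<dots> \<le> exp (2 * real d / real (n + 2)) * exp (2 / real (n + 2))"
    by (intro mult_left_mono) (auto intro!: divide_left_mono)
  also have "\<dots> = exp (2 * real (Suc d) / real (n + 2))"
    by (simp add: algebra_simps add_divide_distrib flip: exp_add)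
  finally show ?case .
qed (use borel_mass_pos[of n] in simp)

lemma borel_mass_ratio_ge: "1 \<le> borel_mass n / borel_mass (n + d)"
  using borel_mass_antimono[of n "n + d"] borel_mass_pos[of "n + d"] by (simp add: le_divide_eq)

lemma borel_mass_ratio_tendsto: "(\<lambda>n. borel_mass n / borel_mass (n + d)) \<longlonglongrightarrow> 1"
proof (rule tendsto_sandwich[where f = "\<lambda>_. 1" and h = "\<lambda>n. exp (2 * real d / real (n + 2))"])
  have "(\<lambda>n. 2 * real d / real (n + 2)) \<longlonglongrightarrow> 0"
    by real_asymp
  then show "(\<lambda>n. exp (2 * real d / real (n + 2))) \<longlonglongrightarrow> 1"
    using tendsto_exp by fastforce
qed (use borel_mass_ratio_le borel_mass_ratio_ge in \<open>auto intro!: always_eventually simp del: of_nat_add\<close>)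

text \<open>
  In the half convolution the index of the second factor is at least \<open>h\<close>, so the quotient of weights
  is bounded by a constant and tends to 1 for each fixed \<open>i\<close>. The lower bound 1 on the quotient gives
  summability, and the upper bound gives the dominating series for Tannery's theorem.
\<close>

lemma borel_mass_sums_1: "borel_mass sums 1"
proof -
  define r where "r h i = borel_mass (2 * h - 1 - i) / borel_mass (2 * h)" for h i
  have split: "2 * h = (2 * h - 1 - i) + Suc i" if "i < h" for h i :: nat
    using that by simp
  have r_ge: "1 \<le> r h i" if "i < h" for h i
    unfolding r_def using borel_mass_ratio_ge[of "2 * h - 1 - i" "Suc i"] split[OF that] by metis
  have r_le: "r h i \<le> exp 2" if "i < h" for h i
  proof -
    have "r h i \<le> exp (2 * real (Suc i) / real (2 * h - 1 - i + 2))"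
      unfolding r_def using borel_mass_ratio_le[of "2 * h - 1 - i" "Suc i"] split[OF that] by metis
    also have "\<dots> \<le> exp 2"
      using that by (simp add: divide_le_eq)
    finally show ?thesis .
  qed
  have r_abs: "\<bar>r h i\<bar> \<le> exp 2" if "i < h" for h i
    using r_ge[OF that] r_le[OF that] by simp
  have half: "(\<Sum>i<h. borel_mass i * r h i) = 2 * real h / (2 * real h + 1)" for h
    unfolding r_def by (rule borel_mass_half_convolution)
  have summable: "summable borel_mass"
  proof (rule summableI_nonneg_bounded)
    fix h
    have "(\<Sum>i<h. borel_mass i) \<le> (\<Sum>i<h. borel_mass i * r h i)"
      using mult_left_mono[OF r_ge] borel_mass_pos by (intro sum_mono) (force simp: less_imp_le)
    also have "\<dots> \<le> 1" unfolding half by (simp add: divide_le_eq)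
    finally show "(\<Sum>i<h. borel_mass i) \<le> 1" .
  qed (simp add: borel_mass_pos less_imp_le)
  define a where "a i h = (if i < h then borel_mass i * r h i else 0)" for i h
  have "(\<lambda>h. a i h) \<longlonglongrightarrow> borel_mass i" for i
  proof -
    have "(\<lambda>h. borel_mass (2 * h - 1 - i) / borel_mass (2 * h - 1 - i + Suc i)) \<longlonglongrightarrow> 1"
      by (rule filterlim_compose[OF borel_mass_ratio_tendsto]) real_asymp
    then have "(\<lambda>h. borel_mass i * (borel_mass (2 * h - 1 - i) / borel_mass (2 * h - 1 - i + Suc i)))
        \<longlonglongrightarrow> borel_mass i * 1"
      by (intro tendsto_intros)
    moreover have "\<forall>\<^sub>F h in sequentially.
        borel_mass i * (borel_mass (2 * h - 1 - i) / borel_mass (2 * h - 1 - i + Suc i)) = a i h"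
      using eventually_gt_at_top[of i]
      by eventually_elim (simp add: a_def r_def flip: split)
    ultimately show ?thesis using Lim_transform_eventually by fastforce
  qed
  moreover have "\<forall>\<^sub>F (i, h) in at_top \<times>\<^sub>F sequentially. norm (a i h) \<le> exp 2 * borel_mass i"
    using r_abs borel_mass_pos
    by (intro always_eventually) (auto simp: a_def abs_mult less_imp_le)
  moreover have "summable (\<lambda>i. exp 2 * borel_mass i)" by (rule summable_mult[OF summable])
  ultimately have "(\<lambda>h. \<Sum>i. a i h) \<longlonglongrightarrow> suminf borel_mass"
    by (intro tannerys_theorem[where M = "\<lambda>i. exp 2 * borel_mass i", THEN conjunct2, THEN conjunct2])
       simp_all
  moreover have "(\<Sum>i. a i h) = 2 * real h / (2 * real h + 1)" for h
  proof -
    have "(\<Sum>i. a i h) = (\<Sum>i<h. a i h)" by (rule suminf_finite) (auto simp: a_def)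
    also have "\<dots> = (\<Sum>i<h. borel_mass i * r h i)" by (simp add: a_def)
    finally show ?thesis using half by simp
  qed
  moreover have "(\<lambda>h. 2 * real h / (2 * real h + 1)) \<longlonglongrightarrow> 1" by real_asymp
  ultimately have "suminf borel_mass = 1" using LIMSEQ_unique by simp
  with summable show ?thesis by (simp add: sums_iff)
qed

section \<open>Asymptotics of the first entry\<close>

text \<open>
  The tail is an infinite series; the total mass 1 turns it into a finite sum.
\<close>

lemma borel_tail_eq: "borel_tail 1 (Suc k) = 1 - (\<Sum>i<k. borel_mass i)"
proof -
  let ?f = "\<lambda>n. ennreal (exp (- 1 * real n) * (1 * real n) ^ (n - 1) / fact n)"
  let ?M = "borel_distribution 1"
  have "borel_tail 1 (Suc k) = measure ?M {Suc k..}"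
    unfolding borel_tail_def
    by (rule arg_cong[where f = "measure ?M"]) (auto simp: borel_distribution_def space_point_measure)
  have "emeasure ?M {Suc k..} = (\<integral>\<^sup>+n. ?f n * indicator {Suc k..} n \<partial>count_space {1..})"
    unfolding borel_distribution_def point_measure_def by (rule emeasure_density) auto
  also have "\<dots> = (\<integral>\<^sup>+n. ?f n \<partial>count_space {Suc k..})"
    by (subst (1 2) nn_integral_count_space_indicator)
       (auto intro!: nn_integral_cong simp: indicator_def)
  also have "\<dots> = (\<integral>\<^sup>+i. ?f (Suc (i + k)) \<partial>count_space UNIV)"
    by (rule nn_integral_bij_count_space[symmetric], rule bij_betwI[of _ _ _ "\<lambda>n. n - Suc k"]) auto
  also have "\<dots> = (\<Sum>i. ennreal (borel_mass (i + k)))"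
    by (simp add: nn_integral_count_space_nat borel_mass_def)
  also have "\<dots> = ennreal (1 - (\<Sum>i<k. borel_mass i))"
    using sums_split_initial_segment[OF borel_mass_sums_1, of k] borel_mass_pos
    by (intro suminf_ennreal_eq) (auto simp: less_imp_le)
  finally have "emeasure ?M {Suc k..} = ennreal (1 - (\<Sum>i<k. borel_mass i))" .
  moreover have "(\<Sum>i<k. borel_mass i) \<le> 1"
    using sum_le_suminf[of borel_mass "{..<k}"] borel_mass_sums_1 borel_mass_pos
    by (auto simp: sums_iff less_imp_le)
  ultimately have "measure ?M {Suc k..} = 1 - (\<Sum>i<k. borel_mass i)"
    by (simp add: measure_def)
  then show ?thesis using \<open>borel_tail 1 (Suc k) = _\<close> by simp
qed

lemma prob_first_entry:
  assumes "b \<ge> 1" "x \<ge> 1"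
  shows "\<P>(\<pi> in random_parking_function b b (Suc n). \<pi> ! 0 = x) = completion_share b n ((x - 1) div b)"
proof -
  let ?PF = "parking_functions b b (Suc n)"
  have ne: "?PF \<noteq> {}"
    using card_parking_functions_pos[OF assms(1), of "Suc n"] by auto
  have "?PF \<inter> {\<pi>. \<pi> ! 0 = x} = (#) x ` completions b n ((x - 1) div b)"
  proof (intro set_eqI)
    fix \<pi>
    show "\<pi> \<in> ?PF \<inter> {\<pi>. \<pi> ! 0 = x} \<longleftrightarrow> \<pi> \<in> (#) x ` completions b n ((x - 1) div b)"
      using Cons_mem_parking_functions[OF assms(2,1)] length_parking_functions[of \<pi> b b "Suc n"]
      by (cases \<pi>) auto
  qed
  then have "card (?PF \<inter> {\<pi>. \<pi> ! 0 = x}) = card (completions b n ((x - 1) div b))"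
    by (simp add: card_image)
  then show ?thesis
    using ne by (simp add: random_parking_function_def completion_share_def measure_pmf_of_set)
qed

lemma completion_share_tendsto:
  assumes "b \<ge> 1"
  shows "(\<lambda>n. completion_share b n k * (real b * real (Suc n))) \<longlonglongrightarrow> 1 + borel_tail 1 (Suc k)"
proof -
  have ratio: "(\<lambda>n. borel_mass (n - i) / borel_mass (Suc n)) \<longlonglongrightarrow> 1" for i
  proof -
    have "(\<lambda>n. borel_mass (n - i) / borel_mass (n - i + Suc i)) \<longlonglongrightarrow> 1"
      by (rule filterlim_compose[OF borel_mass_ratio_tendsto]) real_asymp
    moreover have "\<forall>\<^sub>F n in sequentially.
        borel_mass (n - i) / borel_mass (n - i + Suc i) = borel_mass (n - i) / borel_mass (Suc n)"
      using eventually_ge_at_top[of i] by eventually_elim simp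
    ultimately show ?thesis using Lim_transform_eventually by fastforce
  qed
  have "(\<lambda>n. 2 * real (Suc n) / real (n + 2)) \<longlonglongrightarrow> 2" by real_asymp
  then have "(\<lambda>n. 2 * real (Suc n) / real (n + 2) -
        (\<Sum>i<k. borel_mass i * (borel_mass (n - i) / borel_mass (Suc n))))
      \<longlonglongrightarrow> 2 - (\<Sum>i<k. borel_mass i * 1)"
    by (intro tendsto_intros ratio)
  moreover have "\<forall>\<^sub>F n in sequentially. 2 * real (Suc n) / real (n + 2) -
        (\<Sum>i<k. borel_mass i * (borel_mass (n - i) / borel_mass (Suc n)))
      = completion_share b n k * (real b * real (Suc n))"
    using eventually_ge_at_top[of k]
  proof eventually_elim
    case (elim n)
    then show ?case using completion_share_eq[OF assms, of k n] assms
      by (simp add: left_diff_distrib del: of_nat_Suc of_nat_add)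
  qed
  ultimately show ?thesis
    using Lim_transform_eventually by (fastforce simp: borel_tail_eq)
qed

lemma prob_first_entry_asymp:
  assumes "b \<ge> 1" "x \<ge> 1" "c = 1 + borel_tail 1 (Suc ((x - 1) div b))"
  shows "(\<lambda>m. \<P>(\<pi> in random_parking_function b b m. \<pi> ! 0 = x)) \<sim>[at_top] (\<lambda>m. c / (real b * real m))"
proof (rule asymp_equivI')
  let ?p = "\<lambda>m. \<P>(\<pi> in random_parking_function b b m. \<pi> ! 0 = x)"
  \<comment> \<open>A nonzero constant is what turns the limit of \<open>b m p\<^sub>m\<close> into asymptotic equivalence.\<close>
  have "c > 0"
    unfolding assms(3) borel_tail_def by (simp add: add_pos_nonneg)
  have "(\<lambda>n. ?p (Suc n) * (real b * real (Suc n))) \<longlonglongrightarrow> c"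
    unfolding prob_first_entry[OF assms(1,2)] assms(3) by (rule completion_share_tendsto[OF assms(1)])
  then have "(\<lambda>m. ?p m * (real b * real m)) \<longlonglongrightarrow> c"
    by (rule filterlim_sequentially_Suc[THEN iffD1])
  then have "(\<lambda>m. ?p m * (real b * real m) / c) \<longlonglongrightarrow> c / c"
    using \<open>c > 0\<close> by (intro tendsto_intros) auto
  then show "(\<lambda>m. ?p m / (c / (real b * real m))) \<longlonglongrightarrow> 1"
    using \<open>c > 0\<close> by simp
qed

text \<open>
  The entry \<open>b + j\<close> lies in the block with number \<open>\<lceil>j / b\<rceil>\<close>.
\<close>

lemma nat_ceiling_divide_nat:
  assumes "b \<ge> 1"
  shows "nat \<lceil>real j / real b\<rceil> = (b + j - 1) div b"
proof -
  define q where "q = (b + j - 1) div b"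
  have "q * b \<le> b + j - 1" "b + j - 1 < Suc q * b"
    using assms by (auto simp: q_def dividend_less_div_times)
  then have "q * b < b + j" "j \<le> q * b" using assms by auto
  then have "real q * real b < real b + real j" "real j \<le> real q * real b"
    by (simp_all flip: of_nat_mult of_nat_add)
  then have "\<lceil>real j / real b\<rceil> = int q"
    using assms by (intro ceiling_unique) (auto simp: field_simps)
  then show ?thesis by (simp add: q_def)
qed

theorem corollary3p12:
  fixes j b :: nat
  assumes "b \<ge> 1"
  shows "(\<forall>m\<ge>1. \<forall>k\<in>{1..b}.
            \<P>(\<pi> in random_parking_function b b m. \<pi> ! 0 = k)
              = \<P>(\<pi> in random_parking_function b b m. \<pi> ! 0 = 1))
       \<and> (\<forall>k\<in>{1..b}.
            (\<lambda>m. \<P>(\<pi> in random_parking_function b b m. \<pi> ! 0 = k))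
              \<sim>[at_top] (\<lambda>m. 2 / (real b * real m)))
       \<and> (\<lambda>m. \<P>(\<pi> in random_parking_function b b m. \<pi> ! 0 = b + j))
            \<sim>[at_top] (\<lambda>m. (1 + borel_tail 1 (nat \<lceil>real j / real b\<rceil> + 1)) / (real b * real m))"
proof (intro conjI allI ballI impI)
  fix m k :: nat
  assume "1 \<le> m" "k \<in> {1..b}"
  then obtain n where "m = Suc n" by (cases m) auto
  moreover have "(k - 1) div b = 0" using \<open>k \<in> {1..b}\<close> by auto
  ultimately show "\<P>(\<pi> in random_parking_function b b m. \<pi> ! 0 = k)
      = \<P>(\<pi> in random_parking_function b b m. \<pi> ! 0 = 1)"
    using \<open>k \<in> {1..b}\<close> prob_first_entry[OF assms, of k n] prob_first_entry[OF assms, of 1 n]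
    by simp
next
  fix k assume "k \<in> {1..b}"
  then show "(\<lambda>m. \<P>(\<pi> in random_parking_function b b m. \<pi> ! 0 = k))
      \<sim>[at_top] (\<lambda>m. 2 / (real b * real m))"
    by (intro prob_first_entry_asymp[OF assms]) (auto simp: borel_tail_eq)
next
  show "(\<lambda>m. \<P>(\<pi> in random_parking_function b b m. \<pi> ! 0 = b + j))
      \<sim>[at_top] (\<lambda>m. (1 + borel_tail 1 (nat \<lceil>real j / real b\<rceil> + 1)) / (real b * real m))"
    using assms by (intro prob_first_entry_asymp[OF assms]) (auto simp: nat_ceiling_divide_nat)
qed

end
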